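(* Let $G$ be a group, regarded as a discrete principal bundle $\pi:G\to\{pt\}$ over a point with structure group $G$ acting on itself by right multiplication, and let $e$ be the unit of $G$. For every $f\in \mathrm{Map}(G,G)^{G}$, $f$ is uniquely determined by $f(e)$, and the gauge quandle operation $g_1\triangleleft^f g_2=g_1 f(g_1)^{-1}f(g_2)$ on $G$ is $$g_{1}\triangleleft^{f} g_{2}=\sigma_{f(e)}(g_{1}g_{2}^{-1})\,g_{2}\qquad\text{for all } g_1,g_2\in G,$$ where $\sigma_{f(e)}$ is the inner automorphism $\sigma_{f(e)}(x)=f(e)^{-1}xf(e)$; that is, $(G,\triangleleft^f)$ is the generalized Alexander quandle of $G$ for the inner automorphism $\sigma_{f(e)}$. Conversely, the generalized Alexander quandle of $G$ for any inner automorphism of $G$ is of the form $(G,\triangleleft^f)$ for some $f\in\mathrm{Map}(G,G)^G$.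
   Context: A quandle is a set $X$ with a binary operation $\triangleleft$ such that $(x\triangleleft y)\triangleleft z=(x\triangleleft z)\triangleleft(y\triangleleft z)$ and $x\triangleleft x=x$ for all $x,y,z\in X$, and each map $-\triangleleft x:X\to X$ is bijective. $\mathrm{Map}(G,G)^G$ denotes the set of maps $f:G\to G$ with $f(hg)=g^{-1}f(h)g$ for all $h,g\in G$. In general, for a discrete principal bundle $P$ (a set with a surjection $\pi:P\to M$ and a right $G$-action that preserves the fibers of $\pi$ and is free and transitive on each of them) and $f:P\to G$ with $f(p\cdot g)=g^{-1}f(p)g$, the gauge quandle $(P,\triangleleft^f)$ is given by $p_1\triangleleft^f p_2=p_1\cdot (f(p_1)^{-1}f(p_2))$. For a group $G$ and $\sigma\in\mathrm{Aut}(G)$, the generalized Alexander quandle of $G$ for $\sigma$ is $G$ with the operation $g_1\triangleleft g_2:=\sigma(g_1g_2^{-1})g_2$. *)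

theory Defs
  imports "HOL-Algebra.Bij"
begin

section \<open>Quandles\<close>

record 'a quandle_struct = "'a partial_object" +
  qop :: "'a \<Rightarrow> 'a \<Rightarrow> 'a" (infixl "\<triangleleft>\<index>" 70)

locale quandle =
  fixes Q :: "('a, 'm) quandle_struct_scheme" (structure)
  assumes qop_closed:
      "\<lbrakk>x \<in> carrier Q; y \<in> carrier Q\<rbrakk> \<Longrightarrow> x \<triangleleft> y \<in> carrier Q"
    and right_distrib:
      "\<lbrakk>x \<in> carrier Q; y \<in> carrier Q; z \<in> carrier Q\<rbrakk>
        \<Longrightarrow> (x \<triangleleft> y) \<triangleleft> z = (x \<triangleleft> z) \<triangleleft> (y \<triangleleft> z)"
    and idem: "x \<in> carrier Q \<Longrightarrow> x \<triangleleft> x = x"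
    and right_bij:
      "x \<in> carrier Q \<Longrightarrow> bij_betw (\<lambda>y. y \<triangleleft> x) (carrier Q) (carrier Q)"

text \<open>
  Operations of concrete quandles, maps between carriers and automorphisms (as in
  \<^const>\<open>auto\<close>) are taken to be extensional, i.e. undefined off the carrier.
  Equality in HOL is then equality of the structures or maps in the usual sense.
\<close>

section \<open>Discrete principal bundles and gauge quandles\<close>

text \<open>
  \<open>P\<close> is the total space, \<open>M\<close> the base, \<open>\<pi>\<close> the projection, and \<open>act p g\<close> is
  the right action \<open>p \<cdot> g\<close>.
\<close>

locale discrete_principal_bundle = group G
  for G :: "('g, 'm) monoid_scheme" (structure) +
  fixes P :: "'p set" and M :: "'b set" and \<pi> :: "'p \<Rightarrow> 'b"
    and act :: "'p \<Rightarrow> 'g \<Rightarrow> 'p"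
  assumes proj_surj: "\<pi> ` P = M"
    and act_closed: "\<lbrakk>p \<in> P; g \<in> carrier G\<rbrakk> \<Longrightarrow> act p g \<in> P"
    and act_one: "p \<in> P \<Longrightarrow> act p \<one> = p"
    and act_mult:
      "\<lbrakk>p \<in> P; g \<in> carrier G; h \<in> carrier G\<rbrakk> \<Longrightarrow> act (act p g) h = act p (g \<otimes> h)"
    and act_fiber: "\<lbrakk>p \<in> P; g \<in> carrier G\<rbrakk> \<Longrightarrow> \<pi> (act p g) = \<pi> p"
    and act_free: "\<lbrakk>p \<in> P; g \<in> carrier G; act p g = p\<rbrakk> \<Longrightarrow> g = \<one>"
    and act_transitive:
      "\<lbrakk>p \<in> P; q \<in> P; \<pi> p = \<pi> q\<rbrakk> \<Longrightarrow> \<exists>g\<in>carrier G. act p g = q"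

text \<open>\<open>Map(P, G)\<^sup>G\<close>; for \<open>P = carrier G\<close> and \<open>act = mult G\<close> this is \<open>Map(G, G)\<^sup>G\<close>.\<close>

definition equivariant_maps ::
    "('g, 'm) monoid_scheme \<Rightarrow> 'p set \<Rightarrow> ('p \<Rightarrow> 'g \<Rightarrow> 'p) \<Rightarrow> ('p \<Rightarrow> 'g) set" where
  "equivariant_maps G P act =
    {f \<in> P \<rightarrow>\<^sub>E carrier G. \<forall>p\<in>P. \<forall>g\<in>carrier G.
       f (act p g) = inv\<^bsub>G\<^esub> g \<otimes>\<^bsub>G\<^esub> f p \<otimes>\<^bsub>G\<^esub> g}"

definition gauge_quandle ::
    "('g, 'm) monoid_scheme \<Rightarrow> 'p set \<Rightarrow> ('p \<Rightarrow> 'g \<Rightarrow> 'p) \<Rightarrow> ('p \<Rightarrow> 'g) \<Rightarrow> 'p quandle_struct" where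
  "gauge_quandle G P act f =
    \<lparr>carrier = P,
     qop = (\<lambda>p1\<in>P. \<lambda>p2\<in>P. act p1 (inv\<^bsub>G\<^esub> (f p1) \<otimes>\<^bsub>G\<^esub> f p2))\<rparr>"

section \<open>Generalized Alexander quandles\<close>

definition alexander_quandle ::
    "('g, 'm) monoid_scheme \<Rightarrow> ('g \<Rightarrow> 'g) \<Rightarrow> 'g quandle_struct" where
  "alexander_quandle G \<sigma> =
    \<lparr>carrier = carrier G,
     qop = (\<lambda>x\<in>carrier G. \<lambda>y\<in>carrier G. \<sigma> (x \<otimes>\<^bsub>G\<^esub> inv\<^bsub>G\<^esub> y) \<otimes>\<^bsub>G\<^esub> y)\<rparr>"

definition inner_automorphism :: "('g, 'm) monoid_scheme \<Rightarrow> 'g \<Rightarrow> 'g \<Rightarrow> 'g" where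
  "inner_automorphism G a = (\<lambda>x\<in>carrier G. inv\<^bsub>G\<^esub> a \<otimes>\<^bsub>G\<^esub> x \<otimes>\<^bsub>G\<^esub> a)"

definition inner_automorphisms :: "('g, 'm) monoid_scheme \<Rightarrow> ('g \<Rightarrow> 'g) set" where
  "inner_automorphisms G = inner_automorphism G ` carrier G"

end

theory Submission
  imports Defs
begin

text \<open>
  Equivariance at the unit gives \<open>f g = g\<inverse> f(e) g\<close>. Substituted into
  \<open>g\<^sub>1 f(g\<^sub>1)\<inverse> f(g\<^sub>2)\<close>, this cancels to \<open>f(e)\<inverse> g\<^sub>1 g\<^sub>2\<inverse> f(e) g\<^sub>2\<close>.
  For the converse, conjugating any \<open>a\<close> by \<open>g\<close> in this way defines an equivariant map.
\<close>

context group
begin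

text \<open>Products are normalised with \<open>m_assoc\<close> to right-nested form, where an
  element and its inverse may be adjacent without forming a subterm; these rules cancel such
  pairs.\<close>

lemma inv_mult_cancel:
  assumes "x \<in> carrier G" "y \<in> carrier G"
  shows "inv x \<otimes> (x \<otimes> y) = y" and "x \<otimes> (inv x \<otimes> y) = y"
  using assms by (simp_all flip: m_assoc)

lemma auto_bij_betw: "\<sigma> \<in> auto G \<Longrightarrow> bij_betw \<sigma> (carrier G) (carrier G)"
  by (auto simp: auto_def Bij_def)

lemma auto_group_hom: "\<sigma> \<in> auto G \<Longrightarrow> group_hom G G \<sigma>"
  by (simp add: auto_def group_hom_def group_hom_axioms_def is_group)

lemma right_mult_bij_betw:
  assumes "a \<in> carrier G"
  shows "bij_betw (\<lambda>x. x \<otimes> a) (carrier G) (carrier G)"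
  by (rule bij_betwI[where g = "\<lambda>x. x \<otimes> inv a"]) (use assms in \<open>auto simp: m_assoc\<close>)

text \<open>Both sides of self-distributivity reduce to \<open>\<sigma> (\<sigma> (x \<otimes> inv
  y)) \<otimes> \<sigma> (y \<otimes> inv z) \<otimes> z\<close>. Idempotence is
  \<open>\<sigma> \<one> = \<one>\<close>.\<close>

lemma quandle_alexander_quandle:
  assumes \<sigma>: "\<sigma> \<in> auto G"
  shows "quandle (alexander_quandle G \<sigma>)"
proof -
  interpret \<sigma>: group_hom G G \<sigma>
    by (rule auto_group_hom[OF \<sigma>])
  show ?thesis
  proof (rule quandle.intro, goal_cases)
    case (1 x y)
    then show ?case
      by (simp add: alexander_quandle_def)
  next
    case (2 x y z)
    then show ?case
      by (simp add: alexander_quandle_def m_assoc inv_mult_group inv_mult_cancel)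
  next
    case (3 x)
    then show ?case
      by (simp add: alexander_quandle_def)
  next
    case (4 x)
    then have x: "x \<in> carrier G"
      by (simp add: alexander_quandle_def)
    \<comment> \<open>Right translation in the quandle factors as right multiplication by
      \<open>inv x\<close>, then \<open>\<sigma>\<close>, then right multiplication by
      \<open>x\<close>, each a bijection.\<close>
    have "bij_betw ((\<lambda>y. y \<otimes> x) \<circ> \<sigma> \<circ> (\<lambda>y. y \<otimes> inv x)) (carrier G) (carrier G)"
      using x by (intro bij_betw_trans[OF right_mult_bij_betw]
          bij_betw_trans[OF auto_bij_betw[OF \<sigma>]] right_mult_bij_betw) auto
    also have "bij_betw ((\<lambda>y. y \<otimes> x) \<circ> \<sigma> \<circ> (\<lambda>y. y \<otimes> inv x)) (carrier G) (carrier G) \<longleftrightarrow>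
        bij_betw (\<lambda>y. y \<triangleleft>\<^bsub>alexander_quandle G \<sigma>\<^esub> x) (carrier G) (carrier G)"
      using x by (intro bij_betw_cong) (simp add: alexander_quandle_def)
    finally show ?case
      by (simp add: alexander_quandle_def)
  qed
qed

text \<open>Conjugation by \<open>inv a\<close> is the inverse map; the extensionality that
  \<open>Bij\<close> demands comes from the restriction in
  \<open>inner_automorphism\<close>.\<close>

lemma inner_automorphism_in_auto:
  assumes a: "a \<in> carrier G"
  shows "inner_automorphism G a \<in> auto G"
proof -
  have "bij_betw (inner_automorphism G a) (carrier G) (carrier G)"
    by (rule bij_betwI[where g = "\<lambda>x. a \<otimes> x \<otimes> inv a"])
      (use a in \<open>auto simp: inner_automorphism_def m_assoc inv_mult_cancel\<close>)
  then show ?thesis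
    using a by (auto simp: auto_def Bij_def hom_def inner_automorphism_def m_assoc inv_mult_cancel)
qed

lemma discrete_principal_bundle_point:
  "discrete_principal_bundle G (carrier G) {()} (\<lambda>_. ()) (mult G)"
proof (unfold_locales, goal_cases)
  case 1
  \<comment> \<open>Surjectivity onto a point says that the group is nonempty, which the unit
    witnesses.\<close>
  show ?case
    using one_closed by blast
next
  \<comment> \<open>Transitivity: all of the group is one fiber, and
    \<open>inv p \<otimes> q\<close> carries \<open>p\<close> to \<open>q\<close>.\<close>
  case (7 p q)
  then show ?case
    by (intro bexI[where x = "inv p \<otimes> q"]) (simp_all add: inv_mult_cancel)
qed (simp_all add: m_assoc r_cancel_one')

text \<open>The orbit of \<open>\<one>\<close> is the whole group, so the value there fixes all
  others; off the carrier both maps are \<open>undefined\<close>. Uniqueness follows, since the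
  right side depends on \<open>f\<close> only through \<open>f \<one>\<close>.\<close>

lemma equivariant_map_eq:
  assumes "f \<in> equivariant_maps G (carrier G) (mult G)"
  shows "f = (\<lambda>g\<in>carrier G. inv g \<otimes> f \<one> \<otimes> g)"
proof (rule extensionalityI[of _ "carrier G"])
  show "f \<in> extensional (carrier G)"
    using assms by (auto simp: equivariant_maps_def PiE_def)
  fix g assume g: "g \<in> carrier G"
  then have "f (\<one> \<otimes> g) = inv g \<otimes> f \<one> \<otimes> g"
    using assms one_closed unfolding equivariant_maps_def by blast
  with g show "f g = (\<lambda>g\<in>carrier G. inv g \<otimes> f \<one> \<otimes> g) g"
    by simp
qed simp

lemma equivariant_map_one_closed:
  "f \<in> equivariant_maps G (carrier G) (mult G) \<Longrightarrow> f \<one> \<in> carrier G"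
  by (auto simp: equivariant_maps_def)

text \<open>Supplies the map for the converse: conjugating by \<open>g\<close> and then by
  \<open>h\<close> is conjugating by \<open>g \<otimes> h\<close>.\<close>

lemma conjugation_equivariant:
  assumes "a \<in> carrier G"
  shows "(\<lambda>g\<in>carrier G. inv g \<otimes> a \<otimes> g) \<in> equivariant_maps G (carrier G) (mult G)"
  using assms by (auto simp: equivariant_maps_def inv_mult_group m_assoc)

lemma gauge_quandle_eq_alexander_quandle:
  assumes f: "f \<in> equivariant_maps G (carrier G) (mult G)"
  shows "gauge_quandle G (carrier G) (mult G) f =
    alexander_quandle G (inner_automorphism G (f \<one>))"
proof -
  have "g1 \<otimes> (inv (f g1) \<otimes> f g2) = inner_automorphism G (f \<one>) (g1 \<otimes> inv g2) \<otimes> g2"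
    if "g1 \<in> carrier G" "g2 \<in> carrier G" for g1 g2
    using that equivariant_map_one_closed[OF f]
    \<comment> \<open>The formula for \<open>f\<close> contains \<open>f\<close> again, so only
      \<open>f g1\<close> and \<open>f g2\<close> are expanded while \<open>f \<one>\<close>
      stays.\<close>
    by (subst (1 2) equivariant_map_eq[OF f])
      (simp add: inner_automorphism_def inv_mult_group m_assoc inv_mult_cancel)
  then show ?thesis
    \<comment> \<open>Both operations are restricted to the carrier, so agreement there is equality
      of the structures.\<close>
    by (auto simp: gauge_quandle_def alexander_quandle_def intro!: restrict_ext)
qed

end

theorem mainTheorem2:
  fixes G :: "('g, 'm) monoid_scheme" (structure)
  assumes "group G"
  shows
    "discrete_principal_bundle G (carrier G) {()} (\<lambda>_. ()) (mult G) \<and>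
     (\<forall>f \<in> equivariant_maps G (carrier G) (mult G).
        (\<forall>f' \<in> equivariant_maps G (carrier G) (mult G). f' \<one> = f \<one> \<longrightarrow> f' = f) \<and>
        quandle (gauge_quandle G (carrier G) (mult G) f) \<and>
        (\<forall>g1 \<in> carrier G. \<forall>g2 \<in> carrier G.
           g1 \<triangleleft>\<^bsub>gauge_quandle G (carrier G) (mult G) f\<^esub> g2 = g1 \<otimes> inv (f g1) \<otimes> f g2 \<and>
           g1 \<triangleleft>\<^bsub>gauge_quandle G (carrier G) (mult G) f\<^esub> g2 =
             inner_automorphism G (f \<one>) (g1 \<otimes> inv g2) \<otimes> g2) \<and>
        inner_automorphism G (f \<one>) \<in> auto G \<and>
        gauge_quandle G (carrier G) (mult G) f =
          alexander_quandle G (inner_automorphism G (f \<one>))) \<and>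
     (\<forall>\<sigma> \<in> inner_automorphisms G. \<exists>f \<in> equivariant_maps G (carrier G) (mult G).
        alexander_quandle G \<sigma> = gauge_quandle G (carrier G) (mult G) f)"
proof -
  interpret group G by fact
  let ?E = "equivariant_maps G (carrier G) (mult G)"
  have unique: "f' = f" if "f \<in> ?E" "f' \<in> ?E" "f' \<one> = f \<one>" for f f'
    using equivariant_map_eq[OF that(1)] equivariant_map_eq[OF that(2)] that(3) by metis
  have auto: "inner_automorphism G (f \<one>) \<in> auto G" if "f \<in> ?E" for f
    using that by (intro inner_automorphism_in_auto equivariant_map_one_closed)
  \<comment> \<open>The axioms transfer from the Alexander quandle along the equality of
    structures.\<close>
  have quandle: "quandle (gauge_quandle G (carrier G) (mult G) f)" if "f \<in> ?E" for f
    using that auto by (simp add: gauge_quandle_eq_alexander_quandle quandle_alexander_quandle)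
  have gauge_op: "g1 \<triangleleft>\<^bsub>gauge_quandle G (carrier G) (mult G) f\<^esub> g2 = g1 \<otimes> inv (f g1) \<otimes> f g2"
    if "f \<in> ?E" "g1 \<in> carrier G" "g2 \<in> carrier G" for f g1 g2
  proof -
    have "f g1 \<in> carrier G" "f g2 \<in> carrier G"
      using that by (auto simp: equivariant_maps_def)
    with that show ?thesis
      by (simp add: gauge_quandle_def m_assoc)
  qed
  have alexander_op: "g1 \<triangleleft>\<^bsub>gauge_quandle G (carrier G) (mult G) f\<^esub> g2 =
      inner_automorphism G (f \<one>) (g1 \<otimes> inv g2) \<otimes> g2"
    if "f \<in> ?E" "g1 \<in> carrier G" "g2 \<in> carrier G" for f g1 g2
    using that by (simp add: gauge_quandle_eq_alexander_quandle alexander_quandle_def)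
  have converse: "\<exists>f\<in>?E. alexander_quandle G \<sigma> = gauge_quandle G (carrier G) (mult G) f"
    if \<sigma>: "\<sigma> \<in> inner_automorphisms G" for \<sigma>
  proof -
    obtain a where a: "a \<in> carrier G" and \<sigma>_eq: "\<sigma> = inner_automorphism G a"
      using \<sigma> by (auto simp: inner_automorphisms_def)
    \<comment> \<open>The equivariant map with value \<open>a\<close> at the unit, so that its inner
      automorphism is \<open>\<sigma>\<close>.\<close>
    let ?f = "\<lambda>g\<in>carrier G. inv g \<otimes> a \<otimes> g"
    have "?f \<one> = a"
      using a by simp
    then show ?thesis
      using conjugation_equivariant[OF a]
        gauge_quandle_eq_alexander_quandle[OF conjugation_equivariant[OF a]]
      by (intro bexI[where x = ?f]) (simp_all only: \<sigma>_eq)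
  qed
  show ?thesis
    by (intro conjI ballI impI discrete_principal_bundle_point unique auto quandle gauge_op
        alexander_op gauge_quandle_eq_alexander_quandle converse)
qed

end
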